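(* Assume the standing setting described in the context (in particular $\nu$ ergodic, $\nu$ the unique $\mu$-stationary probability projecting to $\nu_i$, and $\kappa_i>0$). Then almost surely $\nu_{F_i(n)}$ is non-atomic for all $n\in\mathbb{Z}$.
   Context: Standing setting: $d\ge2$, $\mu$ a Borel probability on $\mathrm{GL}(\mathbb{R}^d)$ with $\int|\log\sigma_j(a)|d\mu(a)<\infty$ for all singular values $\sigma_j$. $\mathrm{Flags}(\mathbb{R}^d)$ is the space of complete flags $F=(S_0,\dots,S_d)$; for fixed $i\in\{1,\dots,d-1\}$, $F_i$ is $F$ with $S_i$ removed, an element of $\mathrm{Flags}_i(\mathbb{R}^d)$. $\nu$ is an ergodic (extremal among $\mu$-stationary) $\mu$-stationary probability on $\mathrm{Flags}(\mathbb{R}^d)$, $\nu_i$ its projection to $\mathrm{Flags}_i(\mathbb{R}^d)$, and $\nu$ is the unique $\mu$-stationary probability projecting to $\nu_i$. A Borel disintegration $x_i\mapsto\nu_{x_i}$ of $\nu$ over $\nu_i$ is fixed. $(A(n))_{n\in\mathbb{Z}}$ is i.i.d. with distribution $\mu$ and $(F(n))_{n\in\mathbb{Z}}$ are random flags with distribution $\nu$ such that $((A(n),F(n)))_n$ is stationary, $F(n)$ is independent of $(A(m))_{m\ge n}$, and $A(n+k)\cdots A(n)F(n)=F(n+k+1)$ for $n\in\mathbb{Z},k\ge0$. $S_j(n)$ is the $j$-dimensional subspace of $F(n)$ and $F_i(n)$ the incomplete flag. Lyapunov exponents: $\chi_1+\cdots+\chi_j=\mathbb{E}[\log|\det_{S_j(0)}(A(0))|]$,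 $|\det_S(A)|$ the Jacobian of $A|_S$. $\kappa_i=\mathbb{E}\left[\log\frac{dA(0)\nu_{F_i(0)}}{d\nu_{F_i(1)}}(F(1))\right]$ (here $A(0)\nu_{F_i(0)}\ll\nu_{F_i(1)}$ a.s.), and it is assumed that $\kappa_i>0$. *)

theory Defs
  imports "HOL-Probability.Probability"
begin

text \<open>Complete flags in R^d, d = CARD('n).  A flag is represented by the function
  j \<mapsto> S_j (for j \<le> d), with S_j = {} for j > d to make the representation unique.\<close>

type_synonym 'n flag = "nat \<Rightarrow> (real^'n) set"

definition flags :: "'n::finite flag set" where
  "flags = {F. (\<forall>j\<le>CARD('n). subspace (F j) \<and> dim (F j) = j)
              \<and> (\<forall>j<CARD('n). F j \<subseteq> F (Suc j))
              \<and> (\<forall>j>CARD('n). F j = {})}"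

text \<open>Incomplete flag F_i: S_i removed (represented by setting the i-th entry to {}).\<close>
definition flag_i :: "nat \<Rightarrow> 'n::finite flag \<Rightarrow> 'n flag" where
  "flag_i i F = F(i := {})"

definition flags_i :: "nat \<Rightarrow> 'n::finite flag set" where
  "flags_i i = flag_i i ` flags"

text \<open>Orthogonal projection matrix onto a subspace; used to define the (Borel)
  topology / sigma-algebra on flag spaces.\<close>
definition projm :: "(real^'n::finite) set \<Rightarrow> real^'n^'n" where
  "projm S = matrix (closest_point S)"

definition flagM :: "'n::finite flag measure" where
  "flagM = vimage_algebra flags
      (\<lambda>F. restrict (\<lambda>j. projm (F j)) {..CARD('n)}) (PiM {..CARD('n)} (\<lambda>_. borel))"

definition flag_iM :: "nat \<Rightarrow> 'n::finite flag measure" where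
  "flag_iM i = vimage_algebra (flags_i i)
      (\<lambda>F. restrict (\<lambda>j. projm (F j)) ({..CARD('n)} - {i}))
      (PiM ({..CARD('n)} - {i}) (\<lambda>_. borel))"

text \<open>Action of a matrix on a flag.\<close>
definition act :: "real^'n^'n \<Rightarrow> 'n::finite flag \<Rightarrow> 'n flag" where
  "act A F = (\<lambda>j. (\<lambda>x. A *v x) ` F j)"

text \<open>j-th singular value (Courant--Fischer min-max form), 1 \<le> j \<le> d.\<close>
definition sing_val :: "real^'n^'n \<Rightarrow> nat \<Rightarrow> real" where
  "sing_val A j = Sup {Inf {norm (A *v v) | v. v \<in> V \<and> norm v = 1} | V :: (real^'n::finite) set.
                        subspace V \<and> dim V = j}"

text \<open>mu-stationary probability measures on Flags(R^d).\<close>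
definition stationary :: "(real^'n^'n) measure \<Rightarrow> 'n::finite flag measure \<Rightarrow> bool" where
  "stationary \<mu> N \<longleftrightarrow> prob_space N \<and> sets N = sets flagM \<and>
     (\<forall>E\<in>sets flagM. emeasure N E =
        (\<integral>\<^sup>+ A. emeasure N {F \<in> space flagM. act A F \<in> E} \<partial>\<mu>))"

text \<open>Ergodic = extremal among mu-stationary probabilities.\<close>
definition ergodic_stationary :: "(real^'n^'n) measure \<Rightarrow> 'n::finite flag measure \<Rightarrow> bool" where
  "ergodic_stationary \<mu> N \<longleftrightarrow> stationary \<mu> N \<and>
     \<not> (\<exists>N1 N2 (t::real). stationary \<mu> N1 \<and> stationary \<mu> N2 \<and> N1 \<noteq> N2 \<and> 0 < t \<and> t < 1 \<and>
           (\<forall>E\<in>sets flagM. measure N E = t * measure N1 E + (1 - t) * measure N2 E))"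

text \<open>Product A(n+k) \<cdots> A(n).\<close>
fun mprod :: "(int \<Rightarrow> real^'n^'n) \<Rightarrow> int \<Rightarrow> nat \<Rightarrow> real^'n^'n" where
  "mprod A n 0 = A n"
| "mprod A n (Suc k) = A (n + int (Suc k)) ** mprod A n k"

end

theory Submission
  imports Defs
begin

text \<open>Call a flag \<open>G\<close> atomic if it is an atom of the fibre measure \<open>\<nu>\<^bsub>G\<^sub>i\<^esub>\<close> through it, with
  weight \<open>w(G) = \<nu>\<^bsub>G\<^sub>i\<^esub>{G} > 0\<close>. Evaluating the Radon-Nikodym derivative \<open>R\<close> of
  \<open>A(0)\<nu>\<^bsub>F\<^sub>i(0)\<^esub>\<close> with respect to \<open>\<nu>\<^bsub>F\<^sub>i(1)\<^esub>\<close> at the atom \<open>F(1) = A(0)F(0)\<close> gives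
  \<open>w(F(0)) = R \<cdot> w(F(1))\<close>, so atomic flags stay atomic along the walk. Since \<open>F(0)\<close> and \<open>F(1)\<close>
  have the same law, the set of atomic flags is invariant and ergodicity gives it measure
  \<open>0\<close> or \<open>1\<close>. Measure \<open>0\<close> means, through the disintegration, that almost every fibre measure
  is non-atomic. Measure \<open>1\<close> is impossible: then \<open>log R = \<phi>(F(1)) - \<phi>(F(0))\<close> with
  \<open>\<phi> = -log w \<ge> 0\<close>, and for identically distributed nonnegative \<open>X, Y\<close> one always has
  \<open>E (Y - X)\<^sup>+ \<le> E (X - Y)\<^sup>+\<close>, contradicting \<open>\<kappa>\<^sub>i > 0\<close>.
  Only ergodicity, the disintegration, the relation \<open>F(1) = A(0)F(0)\<close>, the independence of
  \<open>A(0)\<close> and \<open>F(0)\<close> and the absolute continuity are needed.\<close>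

section \<open>Orthogonal projections onto subspaces\<close>

lemma closest_point_subspace_orthogonal:
  fixes S :: "'a::euclidean_space set"
  assumes S: "subspace S" and s: "s \<in> S"
  shows "inner (x - closest_point S x) s = 0"
proof -
  let ?c = "closest_point S x"
  have c: "?c \<in> S"
    using S closest_point_in_set closed_subspace subspace_0 by blast
  have "inner (x - ?c) ((?c + s) - ?c) \<le> 0" "inner (x - ?c) ((?c - s) - ?c) \<le> 0"
    by (rule closest_point_dot;
        use S c s in \<open>simp add: closed_subspace subspace_imp_convex subspace_add subspace_diff\<close>)+
  then show ?thesis by (simp add: inner_diff_right)
qed

lemma closest_point_subspace_eqI:
  fixes S :: "'a::euclidean_space set"
  assumes S: "subspace S" and "y \<in> S" and orth: "\<And>s. s \<in> S \<Longrightarrow> inner (x - y) s = 0"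
  shows "closest_point S x = y"
proof (rule closest_point_unique[symmetric])
  show "convex S" "closed S" using S by (simp_all add: subspace_imp_convex closed_subspace)
  show "y \<in> S" by fact
  show "\<forall>z\<in>S. dist x y \<le> dist x z"
  proof
    fix z assume z: "z \<in> S"
    have "(dist x z)\<^sup>2 = (norm ((x - y) + (y - z)))\<^sup>2" by (simp add: dist_norm)
    also have "\<dots> = (norm (x - y))\<^sup>2 + (norm (y - z))\<^sup>2"
      using orth S \<open>y \<in> S\<close> z by (intro norm_add_Pythagorean) (simp add: orthogonal_def subspace_diff)
    finally have "(dist x y)\<^sup>2 \<le> (dist x z)\<^sup>2" by (simp add: dist_norm)
    then show "dist x y \<le> dist x z" by (simp add: power2_le_iff_abs_le)
  qed
qed

lemma linear_closest_point_subspace: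
  fixes S :: "'a::euclidean_space set"
  assumes S: "subspace S"
  shows "linear (closest_point S)"
proof
  have c: "closest_point S x \<in> S" for x
    using S closest_point_in_set closed_subspace subspace_0 by blast
  note orth = closest_point_subspace_orthogonal[OF S]
  show "closest_point S (x + y) = closest_point S x + closest_point S y" for x y
    using orth[of _ x] orth[of _ y] c
    by (intro closest_point_subspace_eqI[OF S])
       (simp_all add: S subspace_add algebra_simps inner_diff_left inner_add_left)
  show "closest_point S (r *\<^sub>R x) = r *\<^sub>R closest_point S x" for r x
    using orth[of _ x] c
    by (intro closest_point_subspace_eqI[OF S])
       (simp_all add: S subspace_scale flip: scaleR_diff_right)
qed

lemma projm_mult_vector:
  assumes "subspace S"
  shows "projm S *v x = closest_point S x"
  using matrix_works[of "closest_point S"] linear_closest_point_subspace[OF assms]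
  by (simp add: projm_def)

lemma range_projm:
  assumes S: "subspace S"
  shows "range ((*v) (projm S)) = S"
proof -
  have "closest_point S x \<in> S" for x
    using S closest_point_in_set closed_subspace subspace_0 by blast
  moreover have "x \<in> S \<Longrightarrow> closest_point S x = x" for x
    by (simp add: closest_point_self)
  ultimately show ?thesis
    by (auto simp: projm_mult_vector[OF S] image_iff) metis
qed

lemma projm_inject:
  assumes "subspace S" "subspace T"
  shows "projm S = projm T \<longleftrightarrow> S = T"
  using range_projm[OF assms(1)] range_projm[OF assms(2)] by metis

section \<open>The projection onto the range of a matrix depends measurably on the matrix\<close>

declare transpose_matrix_vector[simp del]

lemma inner_transpose_mult_vector:
  fixes M :: "real^'n::finite^'m::finite"
  shows "inner (transpose M *v y) z = inner y (M *v z)"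
  by (simp add: dot_lmul_matrix transpose_matrix_vector)

lemma norm_matrix_vector_mult_le:
  fixes M :: "real^'n::finite^'m::finite"
  shows "norm (M *v x) \<le> norm M * norm x"
proof (rule power2_le_imp_le)
  have "(norm (M *v x))\<^sup>2 = (\<Sum>i\<in>UNIV. (inner (M $ i) x)\<^sup>2)"
    by (simp add: norm_vec_def L2_set_def matrix_vector_mul_component sum_nonneg)
  also have "\<dots> \<le> (\<Sum>i\<in>UNIV. (norm (M $ i) * norm x)\<^sup>2)"
    by (intro sum_mono) (metis power2_abs power_mono[OF Cauchy_Schwarz_ineq2 abs_ge_zero])
  also have "\<dots> = (norm M * norm x)\<^sup>2"
    by (simp add: norm_vec_def L2_set_def sum_nonneg power_mult_distrib sum_distrib_right)
  finally show "(norm (M *v x))\<^sup>2 \<le> (norm M * norm x)\<^sup>2" .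
qed simp

text \<open>One step of the Landweber iteration. Its iterates converge to the projection onto the
  orthogonal complement of the range of \<open>M\<close>, which exhibits the projection onto the range
  as a pointwise limit of continuous functions of \<open>M\<close>.\<close>

definition landweber_step :: "real^'n::finite^'m::finite \<Rightarrow> real^'m \<Rightarrow> real^'m" where
  "landweber_step M y = y - (1 / (1 + (norm M)\<^sup>2)) *\<^sub>R (M *v (transpose M *v y))"

lemma landweber_step_norm_le:
  "(norm (landweber_step M y))\<^sup>2 \<le> (norm y)\<^sup>2 - (norm (transpose M *v y))\<^sup>2 / (1 + (norm M)\<^sup>2)"
proof -
  define s where "s = 1 / (1 + (norm M)\<^sup>2)"
  define u where "u = transpose M *v y"
  have "0 < 1 + (norm M)\<^sup>2" by (simp add: add_pos_nonneg)
  then have s: "0 < s" "s * (norm M)\<^sup>2 \<le> 1" by (simp_all add: s_def field_simps)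
  have yu: "inner y (M *v u) = (norm u)\<^sup>2"
    using inner_transpose_mult_vector[of M y u] by (simp add: u_def power2_norm_eq_inner)
  have "(norm (landweber_step M y))\<^sup>2 = (norm y)\<^sup>2 - 2 * s * inner y (M *v u) + s\<^sup>2 * (norm (M *v u))\<^sup>2"
    unfolding landweber_step_def s_def[symmetric] u_def[symmetric]
    by (simp only: power2_norm_eq_inner)
       (simp add: inner_diff_left inner_diff_right algebra_simps power2_eq_square inner_commute)
  also have "\<dots> \<le> (norm y)\<^sup>2 - 2 * s * (norm u)\<^sup>2 + s * ((s * (norm M)\<^sup>2) * (norm u)\<^sup>2)"
  proof -
    have "(norm (M *v u))\<^sup>2 \<le> (norm M)\<^sup>2 * (norm u)\<^sup>2"
      using power_mono[OF norm_matrix_vector_mult_le norm_ge_zero, of M u 2]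
      by (simp add: power_mult_distrib)
    from mult_left_mono[OF this, of "s\<^sup>2"]
    have "s\<^sup>2 * (norm (M *v u))\<^sup>2 \<le> s * ((s * (norm M)\<^sup>2) * (norm u)\<^sup>2)"
      by (simp add: power2_eq_square algebra_simps)
    then show ?thesis by (simp add: yu)
  qed
  also have "\<dots> \<le> (norm y)\<^sup>2 - s * (norm u)\<^sup>2"
    using s mult_left_mono[OF mult_right_mono[OF s(2), of "(norm u)\<^sup>2"], of s] by simp
  finally show ?thesis by (simp add: s_def u_def)
qed

lemma transpose_mult_vector_eq_0_iff:
  fixes M :: "real^'n::finite^'m::finite"
  shows "transpose M *v y = 0 \<longleftrightarrow> (\<forall>z. inner y (M *v z) = 0)"
  by (metis inner_transpose_mult_vector inner_eq_zero_iff inner_zero_left)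

lemma landweber_step_add:
  "landweber_step M (x + y) = landweber_step M x + landweber_step M y"
  by (simp add: landweber_step_def matrix_vector_right_distrib scaleR_right_distrib)

lemma landweber_step_range:
  assumes "y \<in> range ((*v) M)"
  shows "landweber_step M y \<in> range ((*v) M)"
proof -
  obtain z where y: "y = M *v z" using assms by blast
  have "landweber_step M y = M *v (z - (1 / (1 + (norm M)\<^sup>2)) *\<^sub>R (transpose M *v y))"
    by (simp add: landweber_step_def y matrix_vector_mult_diff_distrib matrix_vector_mult_scaleR)
  then show ?thesis by simp
qed

lemma landweber_step_contracts:
  obtains q where "0 \<le> q" "q < 1"
    "\<And>y. y \<in> range ((*v) M) \<Longrightarrow> (norm (landweber_step M y))\<^sup>2 \<le> q * (norm y)\<^sup>2"
proof -
  have "\<exists>e>0. \<forall>y\<in>range ((*v) M). norm (transpose M *v y) \<ge> e * norm y"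
  proof (rule injective_imp_isometric)
    show "closed (range ((*v) M))" "subspace (range ((*v) M))"
      by (simp_all add: closed_subspace subspace_UNIV linear_subspace_image)
    show "\<forall>y\<in>range ((*v) M). transpose M *v y = 0 \<longrightarrow> y = 0"
      by (metis inner_transpose_mult_vector inner_eq_zero_iff inner_zero_left rangeE)
  qed simp
  then obtain e where e: "0 < e" "\<And>y. y \<in> range ((*v) M) \<Longrightarrow> e * norm y \<le> norm (transpose M *v y)"
    by blast
  define c where "c = min (e\<^sup>2) 1 / (1 + (norm M)\<^sup>2)"
  have "1 \<le> 1 + (norm M)\<^sup>2" by simp
  then have c: "0 < c" "c \<le> 1"
    unfolding c_def using e(1)
    by (smt (verit) divide_pos_pos le_divide_eq_1_pos zero_less_power2 divide_le_eq_1_pos)+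
  show thesis
  proof
    show "0 \<le> 1 - c" "1 - c < 1" using c by simp_all
    fix y assume y: "y \<in> range ((*v) M)"
    have "(e * norm y)\<^sup>2 \<le> (norm (transpose M *v y))\<^sup>2"
      using e(2)[OF y] e(1) by (intro power_mono) auto
    then have "e\<^sup>2 * (norm y)\<^sup>2 \<le> (norm (transpose M *v y))\<^sup>2"
      by (simp add: power_mult_distrib)
    then have "min (e\<^sup>2) 1 * (norm y)\<^sup>2 \<le> (norm (transpose M *v y))\<^sup>2"
      by (meson min.cobounded1 mult_right_mono zero_le_power2 order_trans)
    then have "c * (norm y)\<^sup>2 \<le> (norm (transpose M *v y))\<^sup>2 / (1 + (norm M)\<^sup>2)"
      unfolding c_def times_divide_eq_left by (simp add: divide_right_mono)
    with landweber_step_norm_le[of M y]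
    show "(norm (landweber_step M y))\<^sup>2 \<le> (1 - c) * (norm y)\<^sup>2"
      unfolding left_diff_distrib by linarith
  qed
qed

lemma landweber_iterate_tendsto_zero:
  assumes y: "y \<in> range ((*v) M)"
  shows "(\<lambda>k. (landweber_step M ^^ k) y) \<longlonglongrightarrow> 0"
proof -
  obtain q where q: "0 \<le> q" "q < 1"
    and contr: "\<And>y. y \<in> range ((*v) M) \<Longrightarrow> (norm (landweber_step M y))\<^sup>2 \<le> q * (norm y)\<^sup>2"
    using landweber_step_contracts by blast
  have range: "(landweber_step M ^^ k) y \<in> range ((*v) M)" for k
    by (induction k) (simp_all add: y landweber_step_range)
  have "(norm ((landweber_step M ^^ k) y))\<^sup>2 \<le> q ^ k * (norm y)\<^sup>2" for k
  proof (induction k)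
    case (Suc k)
    then show ?case
      using contr[OF range[of k]] mult_left_mono[OF Suc q(1)] by (simp add: mult.assoc)
  qed simp
  then have "sqrt ((norm ((landweber_step M ^^ k) y))\<^sup>2) \<le> sqrt (q ^ k * (norm y)\<^sup>2)" for k
    by (rule real_sqrt_le_mono)
  then have bound: "norm ((landweber_step M ^^ k) y) \<le> sqrt q ^ k * norm y" for k
    by (simp add: real_sqrt_mult real_sqrt_power)
  have "(\<lambda>k. sqrt q ^ k * norm y) \<longlonglongrightarrow> 0"
    by (rule tendsto_mult_left_zero, rule LIMSEQ_power_zero) (use q in simp)
  then show ?thesis
    by (rule Lim_null_comparison[OF always_eventually, rotated]) (use bound in auto)
qed

lemma landweber_tendsto_closest_point:
  "(\<lambda>k. x - (landweber_step M ^^ k) x) \<longlonglongrightarrow> closest_point (range ((*v) M)) x"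
proof -
  let ?R = "range ((*v) M)"
  have R: "subspace ?R" by (simp add: subspace_UNIV linear_subspace_image)
  define u where "u = closest_point ?R x"
  have u: "u \<in> ?R" using R closest_point_in_set closed_subspace subspace_0 u_def by blast
  have "transpose M *v (x - u) = 0"
    using closest_point_subspace_orthogonal[OF R, of _ x]
    by (simp add: u_def transpose_mult_vector_eq_0_iff)
  then have fixed: "landweber_step M (x - u) = x - u"
    by (simp add: landweber_step_def)
  have "(landweber_step M ^^ k) x = (landweber_step M ^^ k) u + (x - u)" for k
    by (induction k) (simp_all add: landweber_step_add fixed)
  then have "x - (landweber_step M ^^ k) x = u - (landweber_step M ^^ k) u" for k
    by simp
  moreover have "(\<lambda>k. u - (landweber_step M ^^ k) u) \<longlonglongrightarrow> u - 0"
    using landweber_iterate_tendsto_zero[OF u] by (intro tendsto_intros)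
  ultimately show ?thesis by (simp add: u_def)
qed

lemma borel_measurable_vec_componentwise:
  fixes f :: "'b \<Rightarrow> 'a::euclidean_space^'n::finite"
  assumes "\<And>i. (\<lambda>x. f x $ i) \<in> borel_measurable N"
  shows "f \<in> borel_measurable N"
proof (subst borel_measurable_euclidean_space, intro ballI)
  fix b :: "'a^'n" assume "b \<in> Basis"
  then obtain i u where b: "b = axis i u" "u \<in> Basis" by (auto simp: Basis_vec_def)
  have "(\<lambda>x. f x $ i \<bullet> u) \<in> borel_measurable N"
    using assms[of i] by measurable
  then show "(\<lambda>x. f x \<bullet> b) \<in> borel_measurable N" by (simp add: b inner_axis)
qed

lemma borel_measurable_vec_nth[measurable (raw)]:
  fixes f :: "'b \<Rightarrow> 'a::euclidean_space^'n::finite"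
  assumes "f \<in> borel_measurable N"
  shows "(\<lambda>x. f x $ i) \<in> borel_measurable N"
  using borel_measurable_continuous_onI[OF continuous_on_component[OF continuous_on_id]] assms
  by (rule measurable_compose[rotated])

lemma borel_measurable_matrix_vector_mult[measurable (raw)]:
  fixes f :: "'b \<Rightarrow> real^'n::finite^'m::finite" and g :: "'b \<Rightarrow> real^'n"
  assumes [measurable]: "f \<in> borel_measurable N" "g \<in> borel_measurable N"
  shows "(\<lambda>x. f x *v g x) \<in> borel_measurable N"
  by (intro borel_measurable_vec_componentwise) (simp add: matrix_vector_mult_def)

lemma borel_measurable_matrix_mult[measurable (raw)]:
  fixes f :: "'b \<Rightarrow> real^'n::finite^'m::finite" and g :: "'b \<Rightarrow> real^'k::finite^'n"
  assumes [measurable]: "f \<in> borel_measurable N" "g \<in> borel_measurable N"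
  shows "(\<lambda>x. f x ** g x) \<in> borel_measurable N"
  by (intro borel_measurable_vec_componentwise) (simp add: matrix_matrix_mult_def)

lemma borel_measurable_transpose[measurable (raw)]:
  fixes f :: "'b \<Rightarrow> real^'n::finite^'m::finite"
  assumes [measurable]: "f \<in> borel_measurable N"
  shows "(\<lambda>x. transpose (f x)) \<in> borel_measurable N"
  by (intro borel_measurable_vec_componentwise) (simp add: transpose_def)

lemma borel_measurable_det[measurable]:
  "(det :: real^'n::finite^'n \<Rightarrow> real) \<in> borel_measurable borel"
  unfolding det_def by measurable

lemma borel_measurable_landweber_iterate[measurable (raw)]:
  fixes f :: "'b \<Rightarrow> real^'n::finite^'m::finite"
  assumes [measurable]: "f \<in> borel_measurable N"
  shows "(\<lambda>x. (landweber_step (f x) ^^ k) y) \<in> borel_measurable N"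
proof (induction k)
  case (Suc k)
  then show ?case by (simp add: landweber_step_def)
qed simp

lemma borel_measurable_projm_range[measurable (raw)]:
  fixes f :: "'b \<Rightarrow> real^'n::finite^'n"
  assumes [measurable]: "f \<in> borel_measurable N"
  shows "(\<lambda>x. projm (range ((*v) (f x)))) \<in> borel_measurable N"
proof (intro borel_measurable_vec_componentwise)
  fix a b
  have "(\<lambda>k. (axis b 1 - (landweber_step (f x) ^^ k) (axis b 1)) $ a)
      \<longlonglongrightarrow> projm (range ((*v) (f x))) $ a $ b" for x
    using tendsto_vec_nth[OF landweber_tendsto_closest_point] by (simp add: projm_def matrix_def)
  then show "(\<lambda>x. projm (range ((*v) (f x))) $ a $ b) \<in> borel_measurable N"
    by (rule borel_measurable_LIMSEQ_metric[rotated]) measurable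
qed

section \<open>The measurable space of flags\<close>

lemma flags_subspace:
  fixes G :: "'n::finite flag"
  shows "G \<in> flags \<Longrightarrow> j \<le> CARD('n) \<Longrightarrow> subspace (G j)"
  unfolding flags_def by blast

lemma flags_beyond_dim:
  fixes G :: "'n::finite flag"
  shows "G \<in> flags \<Longrightarrow> CARD('n) < j \<Longrightarrow> G j = {}"
  unfolding flags_def by blast

lemma space_flagM: "space (flagM :: 'n::finite flag measure) = flags"
  by (simp add: flagM_def)

lemma flags_eq_iff_projm:
  fixes G G' :: "'n::finite flag"
  assumes "G \<in> flags" "G' \<in> flags"
  shows "G = G' \<longleftrightarrow> (\<forall>j\<in>{..CARD('n)}. projm (G j) = projm (G' j))"
proof (intro iffI ext)
  fix j assume eq: "\<forall>j\<in>{..CARD('n)}. projm (G j) = projm (G' j)"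
  show "G j = G' j"
  proof (cases "j \<le> CARD('n)")
    case True
    then show ?thesis
      using eq projm_inject[OF flags_subspace[OF assms(1) True] flags_subspace[OF assms(2) True]]
      by simp
  next
    case False
    then show ?thesis using flags_beyond_dim[OF assms(1)] flags_beyond_dim[OF assms(2)] by simp
  qed
qed simp

lemma borel_measurable_projm_flag:
  assumes "j \<le> CARD('n::finite)"
  shows "(\<lambda>G::'n flag. projm (G j)) \<in> borel_measurable flagM"
proof -
  have "(\<lambda>G::'n flag. restrict (\<lambda>j. projm (G j)) {..CARD('n)}) \<in> flagM \<rightarrow>\<^sub>M PiM {..CARD('n)} (\<lambda>_. borel)"
    unfolding flagM_def by (rule measurable_vimage_algebra1) (simp add: space_PiM)
  from measurable_compose[OF this measurable_component_singleton[of j]] assms show ?thesis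
    by simp
qed

lemma measurable_flagM_I:
  fixes g :: "'b \<Rightarrow> 'n::finite flag"
  assumes "g \<in> space N \<rightarrow> flags"
    and "\<And>j. j \<le> CARD('n) \<Longrightarrow> (\<lambda>x. projm (g x j)) \<in> borel_measurable N"
  shows "g \<in> N \<rightarrow>\<^sub>M flagM"
  unfolding flagM_def
  by (rule measurable_vimage_algebra2[OF assms(1)], rule measurable_restrict) (use assms(2) in simp)

lemma diagonal_sets_flagM:
  "Sigma (space flagM) (\<lambda>G. {G}) \<in> sets ((flagM :: 'n::finite flag measure) \<Otimes>\<^sub>M flagM)"
proof -
  have "Sigma (space flagM) (\<lambda>G. {G}) = {z \<in> space ((flagM :: 'n flag measure) \<Otimes>\<^sub>M flagM).
      \<forall>j\<in>{..CARD('n)}. projm (fst z j) = projm (snd z j)}"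
    by (auto simp: space_pair_measure space_flagM flags_eq_iff_projm)
  also have "\<dots> \<in> sets (flagM \<Otimes>\<^sub>M flagM)"
  proof (rule sets.sets_Collect_finite_All)
    fix j :: nat assume "j \<in> {..CARD('n)}"
    then have [measurable]: "(\<lambda>G::'n flag. projm (G j)) \<in> borel_measurable flagM"
      by (intro borel_measurable_projm_flag) simp
    show "{z \<in> space ((flagM :: 'n flag measure) \<Otimes>\<^sub>M flagM). projm (fst z j) = projm (snd z j)}
        \<in> sets (flagM \<Otimes>\<^sub>M flagM)"
      by measurable
  qed simp
  finally show ?thesis .
qed

lemma singleton_sets_flagM:
  assumes "G \<in> space (flagM :: 'n::finite flag measure)"
  shows "{G} \<in> sets (flagM :: 'n flag measure)"
proof -
  have "Pair G -` Sigma (space flagM) (\<lambda>G. {G}) = {G}"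
    using assms by auto
  then show ?thesis
    using sets_Pair1[OF diagonal_sets_flagM] by metis
qed

lemma measurable_flag_i[measurable]: "flag_i i \<in> (flagM :: 'n::finite flag measure) \<rightarrow>\<^sub>M flag_iM i"
  unfolding flag_iM_def
proof (rule measurable_vimage_algebra2)
  show "flag_i i \<in> space flagM \<rightarrow> flags_i i"
    unfolding space_flagM flags_i_def by blast
  show "(\<lambda>G::'n flag. \<lambda>j\<in>{..CARD('n)} - {i}. projm (flag_i i G j)) \<in> flagM \<rightarrow>\<^sub>M PiM ({..CARD('n)} - {i}) (\<lambda>_. borel)"
  proof (rule measurable_restrict)
    fix j assume j: "j \<in> {..CARD('n)} - {i}"
    then have "j \<le> CARD('n)" by simp
    from borel_measurable_projm_flag[OF this] j
    show "(\<lambda>G::'n flag. projm (flag_i i G j)) \<in> borel_measurable flagM"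
      by (simp add: flag_i_def)
  qed
qed

section \<open>The action of invertible matrices on flags\<close>

lemma act_flags:
  assumes A: "invertible A" and G: "G \<in> flags"
  shows "act A G \<in> flags"
proof -
  have "dim ((*v) A ` G j) = dim (G j)" for j
    using inj_matrix_vector_mult[OF A] by (intro dim_image_eq) (auto simp: inj_on_def)
  with G show ?thesis
    unfolding flags_def act_def by (auto simp: linear_subspace_image image_mono)
qed

lemma act_inject:
  assumes "invertible A"
  shows "act A G = act A G' \<longleftrightarrow> G = G'"
  using inj_matrix_vector_mult[OF assms] by (auto simp: act_def fun_eq_iff inj_image_eq_iff)

lemma projm_act:
  assumes "G \<in> flags" "j \<le> CARD('n)"
  shows "projm (act A G j) = projm (range ((*v) (A ** projm ((G :: 'n::finite flag) j))))"
proof -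
  have "act A G j = (*v) A ` range ((*v) (projm (G j)))"
    using range_projm[OF flags_subspace[OF assms]] by (simp add: act_def)
  also have "\<dots> = range ((*v) (A ** projm (G j)))"
    by (auto simp: image_iff simp flip: matrix_vector_mul_assoc)
  finally show ?thesis by simp
qed

definition act_GL :: "(real^'n::finite^'n) \<times> 'n flag \<Rightarrow> 'n flag" where
  "act_GL z = (if invertible (fst z) then act (fst z) (snd z) else snd z)"

lemma measurable_act_GL[measurable]: "act_GL \<in> (borel \<Otimes>\<^sub>M flagM) \<rightarrow>\<^sub>M (flagM :: 'n::finite flag measure)"
proof (rule measurable_flagM_I)
  show "act_GL \<in> space (borel \<Otimes>\<^sub>M flagM) \<rightarrow> flags"
    by (auto simp: act_GL_def space_pair_measure space_flagM act_flags)
  fix j assume j: "j \<le> CARD('n)"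
  have [measurable]: "(\<lambda>G::'n flag. projm (G j)) \<in> borel_measurable flagM"
    using j by (rule borel_measurable_projm_flag)
  have "(\<lambda>z. if det (fst z) \<noteq> 0 then projm (range ((*v) (fst z ** projm (snd z j)))) else projm (snd z j))
      \<in> borel_measurable (borel \<Otimes>\<^sub>M (flagM :: 'n flag measure))"
    by measurable
  then show "(\<lambda>z. projm (act_GL z j)) \<in> borel_measurable (borel \<Otimes>\<^sub>M (flagM :: 'n flag measure))"
    by (rule measurable_cong[THEN iffD1, rotated])
       (use j in \<open>auto simp: act_GL_def space_pair_measure space_flagM projm_act invertible_det_nz\<close>)
qed

lemma measurable_act:
  assumes "invertible A"
  shows "act A \<in> (flagM :: 'n::finite flag measure) \<rightarrow>\<^sub>M flagM"
proof -
  have "(\<lambda>G. act_GL (A, G)) \<in> (flagM :: 'n flag measure) \<rightarrow>\<^sub>M flagM" by measurable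
  then show ?thesis using assms by (simp add: act_GL_def)
qed

section \<open>Invariant sets of ergodic stationary measures\<close>

lemma stationaryD:
  assumes "stationary \<mu> N"
  shows "prob_space N" "sets N = sets flagM"
    "\<And>E. E \<in> sets flagM \<Longrightarrow> emeasure N E = (\<integral>\<^sup>+ A. emeasure N {G \<in> space flagM. act A G \<in> E} \<partial>\<mu>)"
  using assms unfolding stationary_def by auto

lemma nn_integral_stationary_invariant_set:
  fixes \<mu> :: "(real^'n::finite^'n) measure" and \<nu> :: "'n flag measure"
  assumes st: "stationary \<mu> \<nu>"
    and mu_prob: "prob_space \<mu>" and mu_sets: "sets \<mu> = sets borel"
    and mu_GL: "AE A in \<mu>. invertible A"
    and S[measurable]: "S \<in> sets flagM"
    and invariant: "AE z in \<mu> \<Otimes>\<^sub>M \<nu>. act_GL z \<in> S \<longleftrightarrow> snd z \<in> S"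
    and E[measurable]: "E \<in> sets flagM"
  shows "(\<integral>\<^sup>+ A. emeasure \<nu> {G \<in> S. act_GL (A, G) \<in> E} \<partial>\<mu>) = emeasure \<nu> (S \<inter> E)"
proof -
  interpret nu: prob_space \<nu> using stationaryD(1)[OF st] .
  interpret mu: prob_space \<mu> by fact
  interpret pair_sigma_finite \<mu> \<nu> by unfold_locales
  have sets_pair: "sets (\<mu> \<Otimes>\<^sub>M \<nu>) = sets (borel \<Otimes>\<^sub>M flagM)"
    by (rule sets_pair_measure_cong[OF mu_sets stationaryD(2)[OF st]])
  define X where "X = {z \<in> space (borel \<Otimes>\<^sub>M flagM). act_GL z \<in> E \<and> snd z \<in> S}"
  define Y where "Y = {z \<in> space (borel \<Otimes>\<^sub>M flagM). act_GL z \<in> E \<inter> S}"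
  have X: "X \<in> sets (\<mu> \<Otimes>\<^sub>M \<nu>)" and Y: "Y \<in> sets (\<mu> \<Otimes>\<^sub>M \<nu>)"
    unfolding X_def Y_def sets_pair by measurable
  have "(\<integral>\<^sup>+ A. emeasure \<nu> {G \<in> S. act_GL (A, G) \<in> E} \<partial>\<mu>) = emeasure (\<mu> \<Otimes>\<^sub>M \<nu>) X"
    unfolding nu.emeasure_pair_measure_alt[OF X]
    using sets.sets_into_space[OF S]
    by (intro nn_integral_cong arg_cong[where f="emeasure \<nu>"]) (auto simp: X_def space_pair_measure)
  also have "\<dots> = emeasure (\<mu> \<Otimes>\<^sub>M \<nu>) Y"
    by (rule emeasure_eq_AE[OF _ X Y])
       (use invariant in \<open>auto simp: X_def Y_def sets_eq_imp_space_eq[OF sets_pair]\<close>)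
  also have "\<dots> = (\<integral>\<^sup>+ A. emeasure \<nu> {G \<in> space flagM. act A G \<in> E \<inter> S} \<partial>\<mu>)"
    unfolding nu.emeasure_pair_measure_alt[OF Y]
    by (rule nn_integral_cong_AE)
       (use mu_GL in \<open>auto simp: Y_def act_GL_def space_pair_measure elim!: AE_mp\<close>)
  also have "\<dots> = emeasure \<nu> (S \<inter> E)"
    by (subst stationaryD(3)[OF st]) (simp_all add: Int_commute)
  finally show ?thesis .
qed

lemma borel_measurable_emeasure_act_GL_slice:
  fixes \<mu> :: "(real^'n::finite^'n) measure" and \<nu> :: "'n flag measure"
  assumes "sets \<mu> = sets borel" "sets \<nu> = sets flagM" "S \<in> sets flagM" "E \<in> sets flagM"
    and [simp]: "prob_space \<nu>"
  shows "(\<lambda>A. emeasure \<nu> {G \<in> S. act_GL (A, G) \<in> E}) \<in> borel_measurable \<mu>"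
proof (rule sigma_finite_measure.measurable_emeasure)
  have sets_pair: "sets (\<mu> \<Otimes>\<^sub>M \<nu>) = sets (borel \<Otimes>\<^sub>M flagM)"
    by (rule sets_pair_measure_cong[OF assms(1,2)])
  show "{z \<in> space (\<mu> \<Otimes>\<^sub>M \<nu>). snd z \<in> {G \<in> S. act_GL (fst z, G) \<in> E}} \<in> sets (\<mu> \<Otimes>\<^sub>M \<nu>)"
    unfolding sets_pair sets_eq_imp_space_eq[OF sets_pair] using assms(3,4) by measurable
qed (use sets.sets_into_space[OF assms(3)] assms(2) in \<open>auto dest: sets_eq_imp_space_eq simp: prob_space_imp_sigma_finite\<close>)

lemma stationary_uniform_measure:
  fixes \<mu> :: "(real^'n::finite^'n) measure" and \<nu> :: "'n flag measure"
  assumes st: "stationary \<mu> \<nu>"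
    and mu_prob: "prob_space \<mu>" and mu_sets: "sets \<mu> = sets borel"
    and mu_GL: "AE A in \<mu>. invertible A"
    and S[measurable]: "S \<in> sets flagM" and pos: "emeasure \<nu> S \<noteq> 0"
    and invariant: "AE z in \<mu> \<Otimes>\<^sub>M \<nu>. act_GL z \<in> S \<longleftrightarrow> snd z \<in> S"
  shows "stationary \<mu> (uniform_measure \<nu> S)"
proof -
  interpret nu: prob_space \<nu> using stationaryD(1)[OF st] .
  have sets_nu: "sets \<nu> = sets flagM" using stationaryD(2)[OF st] .
  have "emeasure (uniform_measure \<nu> S) E
      = (\<integral>\<^sup>+ A. emeasure (uniform_measure \<nu> S) {G \<in> space flagM. act A G \<in> E} \<partial>\<mu>)"
    if E: "E \<in> sets flagM" for E
  proof -
    have "AE A in \<mu>. emeasure (uniform_measure \<nu> S) {G \<in> space flagM. act A G \<in> E}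
        = emeasure \<nu> {G \<in> S. act_GL (A, G) \<in> E} / emeasure \<nu> S"
      using mu_GL
    proof eventually_elim
      case (elim A)
      have "{G \<in> space flagM. act A G \<in> E} = act A -` E \<inter> space flagM" by auto
      then have "{G \<in> space flagM. act A G \<in> E} \<in> sets flagM"
        using measurable_sets[OF measurable_act[OF elim] E] by simp
      moreover have "S \<inter> {G \<in> space flagM. act A G \<in> E} = {G \<in> S. act_GL (A, G) \<in> E}"
        using elim sets.sets_into_space[OF S] by (auto simp: act_GL_def)
      ultimately show ?case using sets_nu by simp
    qed
    moreover have "(\<lambda>A. emeasure \<nu> {G \<in> S. act_GL (A, G) \<in> E}) \<in> borel_measurable \<mu>"
      using mu_sets sets_nu S E nu.prob_space_axioms by (rule borel_measurable_emeasure_act_GL_slice)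
    ultimately have "(\<integral>\<^sup>+ A. emeasure (uniform_measure \<nu> S) {G \<in> space flagM. act A G \<in> E} \<partial>\<mu>)
        = (\<integral>\<^sup>+ A. emeasure \<nu> {G \<in> S. act_GL (A, G) \<in> E} \<partial>\<mu>) / emeasure \<nu> S"
      by (simp add: nn_integral_cong_AE divide_ennreal_def nn_integral_multc)
    also have "\<dots> = emeasure (uniform_measure \<nu> S) E"
      using nn_integral_stationary_invariant_set[OF st mu_prob mu_sets mu_GL S invariant E] E sets_nu
      by simp
    finally show ?thesis ..
  qed
  moreover have "prob_space (uniform_measure \<nu> S)"
    using pos by (intro prob_space_uniform_measure) simp_all
  ultimately show ?thesis
    unfolding stationary_def using sets_nu by simp
qed

lemma AE_invariant_compl:
  fixes \<mu> :: "(real^'n::finite^'n) measure" and \<nu> :: "'n flag measure"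
  assumes "sets \<mu> = sets borel" "sets \<nu> = sets flagM"
    and "AE z in \<mu> \<Otimes>\<^sub>M \<nu>. act_GL z \<in> S \<longleftrightarrow> snd z \<in> S"
  shows "AE z in \<mu> \<Otimes>\<^sub>M \<nu>. act_GL z \<in> space flagM - S \<longleftrightarrow> snd z \<in> space flagM - S"
  using assms(3) AE_space
proof eventually_elim
  case (elim z)
  then have "z \<in> space (borel \<Otimes>\<^sub>M (flagM :: 'n flag measure))"
    using sets_eq_imp_space_eq[OF sets_pair_measure_cong[OF assms(1,2)]] by simp
  then have "act_GL z \<in> space flagM" "snd z \<in> space flagM"
    using measurable_space[OF measurable_act_GL] by (auto simp: space_pair_measure)
  with elim(1) show ?case by blast
qed

lemma ergodic_stationary_invariant_set:
  fixes \<mu> :: "(real^'n::finite^'n) measure" and \<nu> :: "'n flag measure"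
  assumes erg: "ergodic_stationary \<mu> \<nu>"
    and mu_prob: "prob_space \<mu>" and mu_sets: "sets \<mu> = sets borel"
    and mu_GL: "AE A in \<mu>. invertible A"
    and S[measurable]: "S \<in> sets flagM"
    and invariant: "AE z in \<mu> \<Otimes>\<^sub>M \<nu>. act_GL z \<in> S \<longleftrightarrow> snd z \<in> S"
  shows "measure \<nu> S = 0 \<or> measure \<nu> S = 1"
proof (rule ccontr)
  assume "\<not> (measure \<nu> S = 0 \<or> measure \<nu> S = 1)"
  have st: "stationary \<mu> \<nu>" using erg by (simp add: ergodic_stationary_def)
  interpret nu: prob_space \<nu> using stationaryD(1)[OF st] .
  have sets_nu: "sets \<nu> = sets flagM" using stationaryD(2)[OF st] .
  define p where "p = measure \<nu> S"
  define S' where "S' = space flagM - S"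
  have S'[measurable]: "S' \<in> sets flagM" unfolding S'_def by measurable
  have p: "0 < p" "p < 1"
    using \<open>\<not> _\<close> nu.prob_le_1[of S] measure_nonneg[of \<nu> S] unfolding p_def by linarith+
  have p': "measure \<nu> S' = 1 - p"
    using nu.prob_compl[of S] sets_nu sets_eq_imp_space_eq[OF sets_nu] by (simp add: S'_def p_def)
  have "AE z in \<mu> \<Otimes>\<^sub>M \<nu>. act_GL z \<in> S' \<longleftrightarrow> snd z \<in> S'"
    unfolding S'_def by (rule AE_invariant_compl[OF mu_sets sets_nu invariant])
  then have st': "stationary \<mu> (uniform_measure \<nu> S')"
    using p p' sets_nu by (intro stationary_uniform_measure[OF st mu_prob mu_sets mu_GL S'])
      (simp_all add: nu.emeasure_eq_measure)
  have st1: "stationary \<mu> (uniform_measure \<nu> S)"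
    using p sets_nu by (intro stationary_uniform_measure[OF st mu_prob mu_sets mu_GL S _ invariant])
      (simp_all add: nu.emeasure_eq_measure p_def)
  have "S' \<inter> S = {}" by (auto simp: S'_def)
  then have "emeasure (uniform_measure \<nu> S) S \<noteq> emeasure (uniform_measure \<nu> S') S"
    using p sets_nu by (simp add: nu.emeasure_eq_measure p_def)
  then have "uniform_measure \<nu> S \<noteq> uniform_measure \<nu> S'" by metis
  moreover have "measure \<nu> E = p * measure (uniform_measure \<nu> S) E + (1 - p) * measure (uniform_measure \<nu> S') E"
    if E: "E \<in> sets flagM" for E
  proof -
    have "E \<inter> S' = E - S" unfolding S'_def using E sets.sets_into_space by blast
    then have "measure \<nu> E = measure \<nu> (S \<inter> E) + measure \<nu> (S' \<inter> E)"
      using nu.finite_measure_Diff'[of E S] E sets_nu by (simp add: Int_commute)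
    then show ?thesis
      using p p' E sets_nu by (simp add: nu.emeasure_eq_measure p_def)
  qed
  ultimately show False
    using erg st1 st' p unfolding ergodic_stationary_def by blast
qed

section \<open>Facts from measure theory\<close>

lemma nn_integral_pos_part_eq_neg_part:
  fixes f :: "'a \<Rightarrow> real"
  assumes "integrable M f" "integral\<^sup>L M f = 0"
  shows "(\<integral>\<^sup>+x. ennreal (f x) \<partial>M) = (\<integral>\<^sup>+x. ennreal (- f x) \<partial>M)"
proof -
  have "(\<integral>\<^sup>+x. ennreal (f x) \<partial>M) \<noteq> \<top>" "(\<integral>\<^sup>+x. ennreal (- f x) \<partial>M) \<noteq> \<top>"
    using assms(1) by (simp_all add: real_integrable_def)
  moreover have "enn2real (\<integral>\<^sup>+x. ennreal (f x) \<partial>M) = enn2real (\<integral>\<^sup>+x. ennreal (- f x) \<partial>M)"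
    using real_lebesgue_integral_def[OF assms(1)] assms(2) by simp
  ultimately show ?thesis
    by (metis ennreal_enn2real_if)
qed

lemma ennreal_truncated_diff_le:
  fixes x y s t :: real
  shows "s \<le> t \<Longrightarrow> ennreal (min y s - min x s) \<le> ennreal (min y t - min x t)"
    and "ennreal (min y s - min x s) \<le> ennreal (y - x)"
proof -
  have "min y s - min x s \<le> max 0 (min y t - min x t)" if "s \<le> t"
    using that by (auto simp: min_def max_def)
  moreover have "min y s - min x s \<le> max 0 (y - x)"
    by (auto simp: min_def max_def)
  ultimately show "s \<le> t \<Longrightarrow> ennreal (min y s - min x s) \<le> ennreal (min y t - min x t)"
    and "ennreal (min y s - min x s) \<le> ennreal (y - x)"
    by (metis ennreal_leI ennreal_max_0)+
qed
text \<open>After truncation at level \<open>n\<close> both integrals are finite and the claim is an equality.\<close>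

lemma (in prob_space) nn_integral_diff_le_if_identically_distributed:
  fixes X Y :: "'a \<Rightarrow> real"
  assumes [measurable]: "X \<in> borel_measurable M" "Y \<in> borel_measurable M"
    and nonneg: "\<And>x. x \<in> space M \<Longrightarrow> 0 \<le> X x" "\<And>x. x \<in> space M \<Longrightarrow> 0 \<le> Y x"
    and same_distr: "distr M borel X = distr M borel Y"
  shows "(\<integral>\<^sup>+x. ennreal (Y x - X x) \<partial>M) \<le> (\<integral>\<^sup>+x. ennreal (X x - Y x) \<partial>M)"
proof -
  define f where "f n x = ennreal (min (Y x) (real n) - min (X x) (real n))" for n x
  have "(\<lambda>n. \<integral>\<^sup>+x. f n x \<partial>M) \<longlonglongrightarrow> (\<integral>\<^sup>+x. ennreal (Y x - X x) \<partial>M)"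
  proof (rule nn_integral_LIMSEQ)
    show "incseq f" by (auto simp: incseq_def le_fun_def f_def ennreal_truncated_diff_le)
    show "f n \<in> borel_measurable M" for n unfolding f_def by measurable
    fix x
    have "\<forall>\<^sub>F n in sequentially. f n x = ennreal (Y x - X x)"
      using eventually_ge_at_top[of "nat \<lceil>max (X x) (Y x)\<rceil>"]
      by eventually_elim (use real_nat_ceiling_ge[of "max (X x) (Y x)"] in \<open>auto simp: f_def min_def\<close>)
    then show "(\<lambda>n. f n x) \<longlonglongrightarrow> ennreal (Y x - X x)"
      by (rule tendsto_eventually)
  qed
  moreover have "(\<integral>\<^sup>+x. f n x \<partial>M) \<le> (\<integral>\<^sup>+x. ennreal (X x - Y x) \<partial>M)" for n
  proof -
    define T where "T Z = (\<lambda>x. min (Z x) (real n))" for Z :: "'a \<Rightarrow> real"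
    have T_int: "integrable M (T Z)"
      if [measurable]: "Z \<in> borel_measurable M" and "\<And>x. x \<in> space M \<Longrightarrow> 0 \<le> Z x" for Z
      unfolding T_def by (rule integrable_const_bound[where B="real n"]) (use that(2) in auto)
    have "integral\<^sup>L M (T X) = integral\<^sup>L (distr M borel X) (\<lambda>x. min x (real n))"
      by (simp add: T_def integral_distr)
    also have "\<dots> = integral\<^sup>L M (T Y)"
      by (simp add: T_def integral_distr same_distr)
    finally have "integral\<^sup>L M (\<lambda>x. T Y x - T X x) = 0"
      using T_int nonneg by simp
    then have "(\<integral>\<^sup>+x. f n x \<partial>M) = (\<integral>\<^sup>+x. ennreal (T X x - T Y x) \<partial>M)"
      using nn_integral_pos_part_eq_neg_part[of M "\<lambda>x. T Y x - T X x"] T_int nonneg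
      by (simp add: f_def T_def)
    also have "\<dots> \<le> (\<integral>\<^sup>+x. ennreal (X x - Y x) \<partial>M)"
      by (intro nn_integral_mono) (simp add: T_def ennreal_truncated_diff_le)
    finally show ?thesis .
  qed
  ultimately show ?thesis
    by (intro Lim_bounded[where M=0]) auto
qed

lemma (in sigma_finite_measure) emeasure_singleton_RN_deriv:
  assumes "absolutely_continuous M N" "sets N = sets M" "{y} \<in> sets M"
  shows "emeasure N {y} = RN_deriv M N y * emeasure M {y}"
proof -
  have "emeasure N {y} = emeasure (density M (RN_deriv M N)) {y}"
    by (simp add: density_RN_deriv assms)
  also have "\<dots> = RN_deriv M N y * emeasure M {y}"
    using assms(3) by (simp add: emeasure_density)
  finally show ?thesis .
qed

lemma emeasure_distr_singleton_inj:
  assumes f: "f \<in> M \<rightarrow>\<^sub>M N" and "inj_on f (space M)" "x \<in> space M" "{f x} \<in> sets N"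
  shows "emeasure (distr M N f) {f x} = emeasure M {x}"
proof -
  have "f -` {f x} \<inter> space M = {x}"
    using assms(2,3) by (auto dest: inj_onD)
  then show ?thesis
    using emeasure_distr[OF f assms(4)] by simp
qed

lemma (in prob_space) AE_iff_if_AE_imp_and_prob_eq:
  assumes "AE x in M. P x \<longrightarrow> Q x"
    and [measurable]: "Measurable.pred M P" "Measurable.pred M Q"
    and "prob {x \<in> space M. P x} = prob {x \<in> space M. Q x}"
  shows "AE x in M. P x \<longleftrightarrow> Q x"
proof -
  let ?P = "{x \<in> space M. P x}" and ?Q = "{x \<in> space M. Q x}"
  have "prob (?Q \<inter> ?P) = prob ?P"
    using assms(1) by (intro finite_measure_eq_AE) auto
  then have "prob (?Q - ?P) = 0"
    using finite_measure_Diff'[of ?Q ?P] assms(4) by simp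
  then have "AE x in M. x \<notin> ?Q - ?P"
    by (subst prob_eq_0[symmetric]) auto
  with assms(1) AE_space show ?thesis by eventually_elim blast
qed

lemma (in prob_space) distr_pair_eq_pair_measure:
  assumes X: "X \<in> M \<rightarrow>\<^sub>M S" and Y: "Y \<in> M \<rightarrow>\<^sub>M T"
    and indep: "\<And>A B. A \<in> sets S \<Longrightarrow> B \<in> sets T \<Longrightarrow>
      prob {x \<in> space M. X x \<in> A \<and> Y x \<in> B} = prob {x \<in> space M. X x \<in> A} * prob {x \<in> space M. Y x \<in> B}"
  shows "distr M (S \<Otimes>\<^sub>M T) (\<lambda>x. (X x, Y x)) = distr M S X \<Otimes>\<^sub>M distr M T Y"
proof (rule pair_measure_eqI[symmetric])
  interpret X: prob_space "distr M S X" using prob_space_distr[OF X] .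
  interpret Y: prob_space "distr M T Y" using prob_space_distr[OF Y] .
  show "sigma_finite_measure (distr M S X)" "sigma_finite_measure (distr M T Y)" by unfold_locales
  show "sets (distr M S X \<Otimes>\<^sub>M distr M T Y) = sets (distr M (S \<Otimes>\<^sub>M T) (\<lambda>x. (X x, Y x)))"
    using sets_pair_measure_cong[of "distr M S X" S "distr M T Y" T] by simp
  fix A B assume "A \<in> sets (distr M S X)" "B \<in> sets (distr M T Y)"
  then have A: "A \<in> sets S" and B: "B \<in> sets T" by simp_all
  have XY: "(\<lambda>x. (X x, Y x)) \<in> M \<rightarrow>\<^sub>M S \<Otimes>\<^sub>M T" using X Y by (rule measurable_Pair)
  have "(\<lambda>x. (X x, Y x)) -` (A \<times> B) \<inter> space M = {x \<in> space M. X x \<in> A \<and> Y x \<in> B}"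
    "X -` A \<inter> space M = {x \<in> space M. X x \<in> A}" "Y -` B \<inter> space M = {x \<in> space M. Y x \<in> B}"
    by auto
  then have "emeasure (distr M (S \<Otimes>\<^sub>M T) (\<lambda>x. (X x, Y x))) (A \<times> B)
      = prob {x \<in> space M. X x \<in> A \<and> Y x \<in> B}"
    and "emeasure (distr M S X) A = prob {x \<in> space M. X x \<in> A}"
    and "emeasure (distr M T Y) B = prob {x \<in> space M. Y x \<in> B}"
    using emeasure_distr[OF XY] emeasure_distr[OF X A] emeasure_distr[OF Y B] A B
    by (simp_all add: emeasure_eq_measure)
  with indep[OF A B] show "emeasure (distr M S X) A * emeasure (distr M T Y) B
      = emeasure (distr M (S \<Otimes>\<^sub>M T) (\<lambda>x. (X x, Y x))) (A \<times> B)"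
    by (simp add: ennreal_mult)
qed

lemma prob_indep_component:
  fixes A :: "int \<Rightarrow> 'w \<Rightarrow> 'a::topological_space" and F :: "int \<Rightarrow> 'w \<Rightarrow> 'b"
  assumes indep: "\<And>E B. E \<in> sets N \<Longrightarrow> B \<in> sets (PiM {n..} (\<lambda>_. borel)) \<Longrightarrow>
      measure P {\<omega> \<in> space P. F n \<omega> \<in> E \<and> restrict (\<lambda>m. A m \<omega>) {n..} \<in> B}
      = measure P {\<omega> \<in> space P. F n \<omega> \<in> E} * measure P {\<omega> \<in> space P. restrict (\<lambda>m. A m \<omega>) {n..} \<in> B}"
    and B: "B \<in> sets borel" and E: "E \<in> sets N"
  shows "measure P {\<omega> \<in> space P. A n \<omega> \<in> B \<and> F n \<omega> \<in> E}
    = measure P {\<omega> \<in> space P. A n \<omega> \<in> B} * measure P {\<omega> \<in> space P. F n \<omega> \<in> E}"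
proof -
  let ?B = "{f \<in> space (PiM {n..} (\<lambda>_. borel :: 'a measure)). f n \<in> B}"
  have "?B \<in> sets (PiM {n..} (\<lambda>_. borel))"
    using measurable_sets[OF measurable_component_singleton[of n "{n..}" "\<lambda>_. borel"] B]
    by (simp add: vimage_def Int_def conj_commute)
  moreover have "restrict (\<lambda>m. A m \<omega>) {n..} \<in> ?B \<longleftrightarrow> A n \<omega> \<in> B" for \<omega>
    by (simp add: space_PiM)
  ultimately show ?thesis
    using indep[OF E, of ?B] by (simp add: conj_commute mult.commute)
qed

section \<open>Atoms of the fibre measures\<close>

lemma kernel_flag_i:
  assumes K: "K \<in> flag_iM i \<rightarrow>\<^sub>M prob_algebra flagM" and G: "G \<in> space flagM"
  shows "prob_space (K (flag_i i G))" "sets (K (flag_i i G)) = sets flagM"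
  using measurable_space[OF K measurable_space[OF measurable_flag_i G]]
  by (simp_all add: space_prob_algebra)

definition atom_weight :: "nat \<Rightarrow> ('n::finite flag \<Rightarrow> 'n flag measure) \<Rightarrow> 'n flag \<Rightarrow> ennreal" where
  "atom_weight i K G = emeasure (K (flag_i i G)) {G}"

lemma borel_measurable_atom_weight[measurable]:
  assumes "K \<in> flag_iM i \<rightarrow>\<^sub>M prob_algebra flagM"
  shows "atom_weight i K \<in> borel_measurable flagM"
  unfolding atom_weight_def
  by (rule emeasure_measurable_subprob_algebra2[OF diagonal_sets_flagM])
     (rule measurable_compose[OF measurable_flag_i measurable_prob_algebraD[OF assms]])

lemma atom_weight_le_1:
  assumes "K \<in> flag_iM i \<rightarrow>\<^sub>M prob_algebra flagM" "G \<in> space flagM"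
  shows "atom_weight i K G \<le> 1"
  unfolding atom_weight_def using prob_space.emeasure_le_1[OF kernel_flag_i(1)[OF assms]] .

lemma atom_weight_act:
  fixes A :: "real^'n::finite^'n"
  assumes K: "K \<in> flag_iM i \<rightarrow>\<^sub>M prob_algebra flagM" and G: "G \<in> space flagM" and A: "invertible A"
    and ac: "absolutely_continuous (K (flag_i i (act A G))) (distr (K (flag_i i G)) flagM (act A))"
  shows "atom_weight i K G
    = RN_deriv (K (flag_i i (act A G))) (distr (K (flag_i i G)) flagM (act A)) (act A G)
      * atom_weight i K (act A G)"
proof -
  have AG: "act A G \<in> space flagM"
    using G A by (simp add: space_flagM act_flags)
  interpret K1: prob_space "K (flag_i i (act A G))" using kernel_flag_i(1)[OF K AG] .
  have sets0: "sets (K (flag_i i G)) = sets flagM" and sets1: "sets (K (flag_i i (act A G))) = sets flagM"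
    using kernel_flag_i(2)[OF K] G AG by auto
  have act: "act A \<in> K (flag_i i G) \<rightarrow>\<^sub>M flagM"
    using measurable_act[OF A] by (simp add: measurable_cong_sets[OF sets0 refl])
  have "atom_weight i K G = emeasure (distr (K (flag_i i G)) flagM (act A)) {act A G}"
    unfolding atom_weight_def
    by (rule emeasure_distr_singleton_inj[OF act, symmetric])
       (use G A sets0 singleton_sets_flagM[OF AG] in
         \<open>auto simp: inj_on_def act_inject sets_eq_imp_space_eq[OF sets0]\<close>)
  also have "\<dots> = RN_deriv (K (flag_i i (act A G))) (distr (K (flag_i i G)) flagM (act A)) (act A G)
      * atom_weight i K (act A G)"
    unfolding atom_weight_def
    by (rule K1.emeasure_singleton_RN_deriv[OF ac])
       (simp_all add: sets1 singleton_sets_flagM[OF AG])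
  finally show ?thesis .
qed

lemma fibre_measure_no_atoms:
  assumes K: "K \<in> flag_iM i \<rightarrow>\<^sub>M prob_algebra flagM" and x: "x \<in> space (flag_iM i)"
    and fibre: "emeasure (K x) {G \<in> space flagM. flag_i i G = x} = 1"
    and no_atomic_part: "emeasure (K x) {G \<in> space flagM. 0 < atom_weight i K G} = 0"
    and G: "G \<in> space flagM"
  shows "emeasure (K x) {G} = 0"
proof -
  interpret Kx: prob_space "K x"
    using measurable_space[OF K x] by (simp add: space_prob_algebra)
  have sets_Kx: "sets (K x) = sets flagM"
    using measurable_space[OF K x] by (simp add: space_prob_algebra)
  show ?thesis
  proof (cases "flag_i i G = x")
    case True
    let ?H = "{G \<in> space flagM. 0 < atom_weight i K G}"
    have "?H \<in> sets (K x)"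
      unfolding sets_Kx using K by measurable
    then have "emeasure (K x) {G} \<le> emeasure (K x) ?H" if "G \<in> ?H"
      using that by (intro emeasure_mono) auto
    with True G no_atomic_part show ?thesis
      by (auto simp: atom_weight_def zero_less_iff_neq_zero)
  next
    case False
    let ?fibre = "{G \<in> space flagM. flag_i i G = x}"
    have fibre_sets: "?fibre \<in> sets (K x)"
      using fibre emeasure_notin_sets by force
    note space_Kx = sets_eq_imp_space_eq[OF sets_Kx]
    have "emeasure (K x) {G} \<le> emeasure (K x) (space flagM - ?fibre)"
      using G False sets.compl_sets[OF fibre_sets] space_Kx by (intro emeasure_mono) auto
    also have "\<dots> = 0"
      using Kx.prob_compl[OF fibre_sets] fibre space_Kx by (simp add: Kx.emeasure_eq_measure)
    finally show ?thesis by simp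
  qed
qed

lemma AE_fibre_measure_no_atoms:
  fixes \<nu> :: "'n::finite flag measure"
  assumes K: "K \<in> flag_iM i \<rightarrow>\<^sub>M prob_algebra flagM"
    and disint: "\<And>E. E \<in> sets flagM \<Longrightarrow>
      emeasure \<nu> E = (\<integral>\<^sup>+ x. emeasure (K x) E \<partial>(distr \<nu> (flag_iM i) (flag_i i)))"
    and fibre: "AE x in distr \<nu> (flag_iM i) (flag_i i). emeasure (K x) {G \<in> space flagM. flag_i i G = x} = 1"
    and no_atomic_part: "emeasure \<nu> {G \<in> space flagM. 0 < atom_weight i K G} = 0"
  shows "AE x in distr \<nu> (flag_iM i) (flag_i i). \<forall>G \<in> space flagM. emeasure (K x) {G} = 0"
proof -
  let ?H = "{G \<in> space flagM. 0 < atom_weight i K G}"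
  have H[measurable]: "?H \<in> sets flagM" using K by measurable
  have "(\<integral>\<^sup>+ x. emeasure (K x) ?H \<partial>(distr \<nu> (flag_iM i) (flag_i i))) = 0"
    using disint[OF H] no_atomic_part by simp
  then have "AE x in distr \<nu> (flag_iM i) (flag_i i). emeasure (K x) ?H = 0"
    by (subst (asm) nn_integral_0_iff_AE)
       (simp add: measurable_compose[OF measurable_prob_algebraD[OF K] measurable_emeasure_subprob_algebra[OF H]])
  with fibre AE_space show ?thesis
  proof eventually_elim
    case (elim x)
    then show ?case
      using fibre_measure_no_atoms[OF K _ elim(1) elim(3)] by simp
  qed
qed

lemma ln_enn2real_eq_diff_if_mult_eq:
  fixes a b r :: ennreal
  assumes "a = r * b" "0 < a" "a < \<top>" "0 < b" "b < \<top>"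
  shows "ln (enn2real r) = ln (enn2real a) - ln (enn2real b)"
proof -
  have "r < \<top>" "r \<noteq> 0" using assms by (auto simp: ennreal_mult_less_top)
  then have "enn2real a = enn2real r * enn2real b" "0 < enn2real r" "0 < enn2real b"
    using assms by (auto simp: enn2real_mult enn2real_positive_iff zero_less_iff_neq_zero)
  then show ?thesis by (simp add: ln_mult)
qed

lemma ln_enn2real_nonpos:
  fixes x :: ennreal
  assumes "x \<le> 1"
  shows "ln (enn2real x) \<le> 0"
proof (cases "enn2real x = 0")
  case False
  then show ?thesis
    using assms by (simp add: enn2real_leI less_le)
qed simp

section \<open>One step of a stationary random walk on flags\<close>

locale flag_walk_step =
  fixes \<mu> :: "(real^'n::finite^'n) measure" and \<nu> :: "'n flag measure" and i :: nat
    and K :: "'n flag \<Rightarrow> 'n flag measure"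
    and P :: "'w measure" and A :: "'w \<Rightarrow> real^'n^'n" and F :: "int \<Rightarrow> 'w \<Rightarrow> 'n flag"
  assumes mu_prob: "prob_space \<mu>" and mu_sets: "sets \<mu> = sets borel"
    and mu_GL: "AE a in \<mu>. invertible a"
    and nu_erg: "ergodic_stationary \<mu> \<nu>"
    and K_meas: "K \<in> flag_iM i \<rightarrow>\<^sub>M prob_algebra flagM"
    and K_disint: "\<And>E. E \<in> sets flagM \<Longrightarrow>
      emeasure \<nu> E = (\<integral>\<^sup>+ x. emeasure (K x) E \<partial>(distr \<nu> (flag_iM i) (flag_i i)))"
    and K_fiber: "AE x in distr \<nu> (flag_iM i) (flag_i i).
      emeasure (K x) {G \<in> space flagM. flag_i i G = x} = 1"
    and P_prob: "prob_space P"
    and A_meas[measurable]: "A \<in> P \<rightarrow>\<^sub>M borel"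
    and F_meas[measurable]: "\<And>n. F n \<in> P \<rightarrow>\<^sub>M flagM"
    and A_distr: "distr P borel A = \<mu>"
    and F_distr: "\<And>n. distr P flagM (F n) = \<nu>"
    and joint_distr: "distr P (borel \<Otimes>\<^sub>M flagM) (\<lambda>\<omega>. (A \<omega>, F 0 \<omega>)) = \<mu> \<Otimes>\<^sub>M \<nu>"
    and step: "AE \<omega> in P. act (A \<omega>) (F 0 \<omega>) = F 1 \<omega>"
    and abs_cont: "AE \<omega> in P. absolutely_continuous (K (flag_i i (F 1 \<omega>)))
      (distr (K (flag_i i (F 0 \<omega>))) flagM (act (A \<omega>)))"
begin

abbreviation atoms :: "'n flag set" where
  "atoms \<equiv> {G \<in> space flagM. 0 < atom_weight i K G}"

text \<open>The expectation of the logarithm of \<open>density_step\<close> is \<open>\<kappa>\<^sub>i\<close>; \<open>A\<close> is the first step \<open>A(0)\<close>.\<close>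

abbreviation density_step :: "'w \<Rightarrow> ennreal" where
  "density_step \<omega> \<equiv> RN_deriv (K (flag_i i (F 1 \<omega>))) (distr (K (flag_i i (F 0 \<omega>))) flagM (act (A \<omega>))) (F 1 \<omega>)"

sublocale P: prob_space P by (rule P_prob)

sublocale nu: prob_space \<nu>
  using nu_erg by (simp add: ergodic_stationary_def stationary_def)

lemma sets_nu: "sets \<nu> = sets flagM"
  using nu_erg by (simp add: ergodic_stationary_def stationary_def)

lemma atoms_sets[measurable]: "atoms \<in> sets flagM"
  using K_meas by measurable

lemma AE_invertible: "AE \<omega> in P. invertible (A \<omega>)"
  using mu_GL unfolding A_distr[symmetric] by (rule AE_distrD[OF A_meas])

lemma AE_atom_weight_step: "AE \<omega> in P. atom_weight i K (F 0 \<omega>) = density_step \<omega> * atom_weight i K (F 1 \<omega>)"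
  using AE_space AE_invertible step abs_cont
proof eventually_elim
  case (elim \<omega>)
  then show ?case
    using atom_weight_act[OF K_meas measurable_space[OF F_meas elim(1)] elim(2)] by simp
qed

lemma AE_atoms_invariant: "AE \<omega> in P. F 0 \<omega> \<in> atoms \<longleftrightarrow> F 1 \<omega> \<in> atoms"
proof (rule P.AE_iff_if_AE_imp_and_prob_eq)
  show "AE \<omega> in P. F 0 \<omega> \<in> atoms \<longrightarrow> F 1 \<omega> \<in> atoms"
    using AE_atom_weight_step AE_space
    by eventually_elim (auto simp: zero_less_iff_neq_zero measurable_space[OF F_meas])
  show "P.prob {\<omega> \<in> space P. F 0 \<omega> \<in> atoms} = P.prob {\<omega> \<in> space P. F 1 \<omega> \<in> atoms}"
    using measure_distr[OF F_meas atoms_sets, symmetric] F_distr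
    by (simp add: vimage_def Int_def conj_commute)
qed measurable

lemma measure_atoms_0_or_1: "measure \<nu> atoms = 0 \<or> measure \<nu> atoms = 1"
proof (rule ergodic_stationary_invariant_set[OF nu_erg mu_prob mu_sets mu_GL atoms_sets])
  have "AE \<omega> in P. act_GL (A \<omega>, F 0 \<omega>) \<in> atoms \<longleftrightarrow> F 0 \<omega> \<in> atoms"
    using AE_invertible step AE_atoms_invariant by eventually_elim (simp add: act_GL_def)
  then show "AE z in \<mu> \<Otimes>\<^sub>M \<nu>. act_GL z \<in> atoms \<longleftrightarrow> snd z \<in> atoms"
    unfolding joint_distr[symmetric] by (subst AE_distr_iff) simp_all
qed

lemma no_atoms_if_measure_atoms_0:
  assumes "measure \<nu> atoms = 0"
  shows "AE \<omega> in P. \<forall>n. \<forall>G \<in> space flagM. emeasure (K (flag_i i (F n \<omega>))) {G} = 0"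
proof -
  have "emeasure \<nu> atoms = 0"
    using assms by (simp add: nu.emeasure_eq_measure)
  with K_disint have "AE x in distr \<nu> (flag_iM i) (flag_i i). \<forall>G \<in> space flagM. emeasure (K x) {G} = 0"
    by (rule AE_fibre_measure_no_atoms[OF K_meas _ K_fiber])
  then have "AE \<omega> in P. \<forall>G \<in> space flagM. emeasure (K (flag_i i (F n \<omega>))) {G} = 0" for n
    unfolding F_distr[of n, symmetric] distr_distr[OF measurable_flag_i F_meas]
    by (auto dest: AE_distrD[rotated] simp: comp_def)
  then show ?thesis by (simp add: AE_all_countable)
qed

lemma AE_log_density_step:
  assumes "measure \<nu> atoms = 1"
  shows "AE \<omega> in P. ln (enn2real (density_step \<omega>))
    = ln (enn2real (atom_weight i K (F 0 \<omega>))) - ln (enn2real (atom_weight i K (F 1 \<omega>)))"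
proof -
  have in_atoms: "AE \<omega> in P. F n \<omega> \<in> atoms" for n
    using nu.AE_prob_1[OF assms] unfolding F_distr[of n, symmetric] by (rule AE_distrD[OF F_meas])
  have bounds: "0 < atom_weight i K G" "atom_weight i K G < \<top>" if "G \<in> atoms" for G
    using that le_less_trans[OF atom_weight_le_1[OF K_meas] ennreal_one_less_top] by auto
  show ?thesis
    using AE_atom_weight_step in_atoms[of 0] in_atoms[of 1]
  proof eventually_elim
    case (elim \<omega>)
    from bounds[OF elim(2)] bounds[OF elim(3)] show ?case
      by (rule ln_enn2real_eq_diff_if_mult_eq[OF elim(1)])
  qed
qed

lemma log_density_step_pos_part_le_neg_part:
  assumes "measure \<nu> atoms = 1"
  shows "(\<integral>\<^sup>+\<omega>. ennreal (max 0 (ln (enn2real (density_step \<omega>)))) \<partial>P)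
    \<le> (\<integral>\<^sup>+\<omega>. ennreal (max 0 (- ln (enn2real (density_step \<omega>)))) \<partial>P)"
proof -
  define \<phi> where "\<phi> G = - ln (enn2real (atom_weight i K G))" for G
  have \<phi>_meas[measurable]: "\<phi> \<in> borel_measurable flagM"
    unfolding \<phi>_def using K_meas by measurable
  have "AE \<omega> in P. ennreal (max 0 (ln (enn2real (density_step \<omega>)))) = ennreal (\<phi> (F 1 \<omega>) - \<phi> (F 0 \<omega>))"
    "AE \<omega> in P. ennreal (\<phi> (F 0 \<omega>) - \<phi> (F 1 \<omega>)) = ennreal (max 0 (- ln (enn2real (density_step \<omega>))))"
    using AE_log_density_step[OF assms] by (eventually_elim, simp add: ennreal_max_0 \<phi>_def)+
  then have "(\<integral>\<^sup>+\<omega>. ennreal (max 0 (ln (enn2real (density_step \<omega>)))) \<partial>P)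
      = (\<integral>\<^sup>+\<omega>. ennreal (\<phi> (F 1 \<omega>) - \<phi> (F 0 \<omega>)) \<partial>P)"
    and "(\<integral>\<^sup>+\<omega>. ennreal (\<phi> (F 0 \<omega>) - \<phi> (F 1 \<omega>)) \<partial>P)
      = (\<integral>\<^sup>+\<omega>. ennreal (max 0 (- ln (enn2real (density_step \<omega>)))) \<partial>P)"
    by (simp_all add: nn_integral_cong_AE)
  moreover have "(\<integral>\<^sup>+\<omega>. ennreal (\<phi> (F 1 \<omega>) - \<phi> (F 0 \<omega>)) \<partial>P)
      \<le> (\<integral>\<^sup>+\<omega>. ennreal (\<phi> (F 0 \<omega>) - \<phi> (F 1 \<omega>)) \<partial>P)"
  proof (rule P.nn_integral_diff_le_if_identically_distributed)
    show "(\<lambda>\<omega>. \<phi> (F 0 \<omega>)) \<in> borel_measurable P" "(\<lambda>\<omega>. \<phi> (F 1 \<omega>)) \<in> borel_measurable P"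
      by measurable
    have "0 \<le> \<phi> (F n \<omega>)" if "\<omega> \<in> space P" for n \<omega>
      using ln_enn2real_nonpos[OF atom_weight_le_1[OF K_meas measurable_space[OF F_meas that]]]
      by (simp add: \<phi>_def)
    then show "0 \<le> \<phi> (F 0 \<omega>)" "0 \<le> \<phi> (F 1 \<omega>)" if "\<omega> \<in> space P" for \<omega>
      using that by blast+
    show "distr P borel (\<lambda>\<omega>. \<phi> (F 0 \<omega>)) = distr P borel (\<lambda>\<omega>. \<phi> (F 1 \<omega>))"
      using distr_distr[OF \<phi>_meas F_meas] by (simp add: F_distr comp_def)
  qed
  ultimately show ?thesis by simp
qed

theorem AE_no_atoms_along_walk:
  assumes "(\<integral>\<^sup>+\<omega>. ennreal (max 0 (- ln (enn2real (density_step \<omega>)))) \<partial>P)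
    < (\<integral>\<^sup>+\<omega>. ennreal (max 0 (ln (enn2real (density_step \<omega>)))) \<partial>P)"
  shows "AE \<omega> in P. \<forall>n. \<forall>G \<in> space flagM. emeasure (K (flag_i i (F n \<omega>))) {G} = 0"
  using measure_atoms_0_or_1 no_atoms_if_measure_atoms_0 log_density_step_pos_part_le_neg_part assms
  by (auto simp: not_le[symmetric])

end

theorem lemma4:
  fixes \<mu> :: "(real^'n::finite^'n) measure"
    and \<nu> :: "'n flag measure"
    and i :: nat
    and K :: "'n flag \<Rightarrow> 'n flag measure"
    and P :: "'w measure"
    and A :: "int \<Rightarrow> 'w \<Rightarrow> real^'n^'n"
    and F :: "int \<Rightarrow> 'w \<Rightarrow> 'n flag"
  assumes d2: "CARD('n) \<ge> 2"
    and i_range: "1 \<le> i" "i \<le> CARD('n) - 1"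
    \<comment> \<open>mu: Borel probability on GL(R^d) with integrable log singular values\<close>
    and mu_prob: "prob_space \<mu>" and mu_sets: "sets \<mu> = sets borel"
    and mu_GL: "AE a in \<mu>. invertible a"
    and mu_int: "\<And>j. 1 \<le> j \<Longrightarrow> j \<le> CARD('n) \<Longrightarrow> integrable \<mu> (\<lambda>a. \<bar>ln (sing_val a j)\<bar>)"
    \<comment> \<open>nu ergodic stationary, unique stationary lift of nu_i\<close>
    and nu_erg: "ergodic_stationary \<mu> \<nu>"
    and nu_unique: "\<And>N. stationary \<mu> N \<Longrightarrow>
          distr N (flag_iM i) (flag_i i) = distr \<nu> (flag_iM i) (flag_i i) \<Longrightarrow> N = \<nu>"
    \<comment> \<open>Borel disintegration of nu over nu_i\<close>
    and K_meas: "K \<in> measurable (flag_iM i) (prob_algebra flagM)"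
    and K_disint: "\<And>E. E \<in> sets flagM \<Longrightarrow>
          emeasure \<nu> E = (\<integral>\<^sup>+ x. emeasure (K x) E \<partial>(distr \<nu> (flag_iM i) (flag_i i)))"
    and K_fiber: "AE x in distr \<nu> (flag_iM i) (flag_i i).
          emeasure (K x) {G \<in> space flagM. flag_i i G = x} = 1"
    \<comment> \<open>the random process\<close>
    and P_prob: "prob_space P"
    and A_meas: "\<And>n. A n \<in> measurable P borel"
    and F_meas: "\<And>n. F n \<in> measurable P flagM"
    and A_indep: "prob_space.indep_vars P (\<lambda>_. borel) A UNIV"
    and A_distr: "\<And>n. distr P borel (A n) = \<mu>"
    and F_distr: "\<And>n. distr P flagM (F n) = \<nu>"
    and stat: "\<And>k. distr P (PiM UNIV (\<lambda>_. pair_measure borel flagM)) (\<lambda>\<omega> n. (A (n + k) \<omega>, F (n + k) \<omega>))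
                   = distr P (PiM UNIV (\<lambda>_. pair_measure borel flagM)) (\<lambda>\<omega> n. (A n \<omega>, F n \<omega>))"
    and F_indep: "\<And>n E B. E \<in> sets flagM \<Longrightarrow> B \<in> sets (PiM {n..} (\<lambda>_. borel)) \<Longrightarrow>
          measure P {\<omega> \<in> space P. F n \<omega> \<in> E \<and> restrict (\<lambda>m. A m \<omega>) {n..} \<in> B}
          = measure P {\<omega> \<in> space P. F n \<omega> \<in> E} * measure P {\<omega> \<in> space P. restrict (\<lambda>m. A m \<omega>) {n..} \<in> B}"
    and cocycle: "\<And>n k. AE \<omega> in P. act (mprod (\<lambda>m. A m \<omega>) n k) (F n \<omega>) = F (n + int k + 1) \<omega>"
    \<comment> \<open>kappa_i is well defined and positive\<close>
    and abs_cont: "AE \<omega> in P. absolutely_continuous (K (flag_i i (F 1 \<omega>)))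
                      (distr (K (flag_i i (F 0 \<omega>))) flagM (act (A 0 \<omega>)))"
    and kappa_neg_fin: "(\<integral>\<^sup>+ \<omega>. ennreal (max 0 (- ln (enn2real (RN_deriv (K (flag_i i (F 1 \<omega>)))
                      (distr (K (flag_i i (F 0 \<omega>))) flagM (act (A 0 \<omega>))) (F 1 \<omega>))))) \<partial>P) < \<infinity>"
    and kappa_pos: "(\<integral>\<^sup>+ \<omega>. ennreal (max 0 (- ln (enn2real (RN_deriv (K (flag_i i (F 1 \<omega>)))
                      (distr (K (flag_i i (F 0 \<omega>))) flagM (act (A 0 \<omega>))) (F 1 \<omega>))))) \<partial>P)
                  < (\<integral>\<^sup>+ \<omega>. ennreal (max 0 (ln (enn2real (RN_deriv (K (flag_i i (F 1 \<omega>)))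
                      (distr (K (flag_i i (F 0 \<omega>))) flagM (act (A 0 \<omega>))) (F 1 \<omega>))))) \<partial>P)"
  shows "AE \<omega> in P. \<forall>n. \<forall>G \<in> space flagM. emeasure (K (flag_i i (F n \<omega>))) {G} = 0"
proof -
  interpret P: prob_space P by (rule P_prob)
  have "P.prob {\<omega> \<in> space P. A 0 \<omega> \<in> B \<and> F 0 \<omega> \<in> E}
      = P.prob {\<omega> \<in> space P. A 0 \<omega> \<in> B} * P.prob {\<omega> \<in> space P. F 0 \<omega> \<in> E}"
    if "B \<in> sets borel" "E \<in> sets flagM" for B E
    using F_indep that by (rule prob_indep_component)
  then have "distr P (borel \<Otimes>\<^sub>M flagM) (\<lambda>\<omega>. (A 0 \<omega>, F 0 \<omega>)) = \<mu> \<Otimes>\<^sub>M \<nu>"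
    using P.distr_pair_eq_pair_measure[OF A_meas F_meas] by (simp add: A_distr F_distr)
  moreover have "AE \<omega> in P. act (A 0 \<omega>) (F 0 \<omega>) = F 1 \<omega>"
    using cocycle[of 0 0] by simp
  ultimately interpret flag_walk_step \<mu> \<nu> i K P "A 0" F
    using mu_prob mu_sets mu_GL nu_erg K_meas K_disint K_fiber P_prob A_meas F_meas A_distr F_distr
      abs_cont
    by (intro flag_walk_step.intro) simp_all
  show ?thesis
    using AE_no_atoms_along_walk kappa_pos by blast
qed

end
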